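(* For $n\ge 1$ let $a_n = |S_n^2(132,213,312)|$. Then $a_1=1$ and $a_{n+1} = 2(n+1)$ for all $n\ge 1$.
   Context: A $3$-permutation of size $n$ is an ordered pair $(\sigma,\sigma')$ of permutations of $[n]=\{1,\dots,n\}$. A (classical) permutation $\tau\in S_n$ contains a pattern $\pi\in S_k$ if there are indices $c_1<\dots<c_k$ such that $\tau(c_1)\cdots\tau(c_k)$ is order-isomorphic to $\pi$, and avoids $\pi$ otherwise. A $3$-permutation $(\sigma,\sigma')$ avoids a pattern $\pi\in S_k$ if each of the three permutations $\sigma$, $\sigma'$, and $\sigma'\circ\sigma^{-1}$ (where $(\sigma'\circ\sigma^{-1})(i)=\sigma'(\sigma^{-1}(i))$) avoids $\pi$. $S_n^2(\pi_1,\dots,\pi_m)$ denotes the set of $3$-permutations of size $n$ avoiding each of $\pi_1,\dots,\pi_m$. Patterns are written in one-line notation. *)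

theory Defs
  imports "HOL-Combinatorics.Permutations"
begin

text \<open>
  Elements of \<open>S\<^sub>n\<close> are functions \<open>nat \<Rightarrow> nat\<close> with \<open>\<tau> permutes {1..n}\<close>, which are the identity
  outside \<open>{1..n}\<close>. A pattern \<open>\<pi> \<in> S\<^sub>k\<close> is given by its one-line notation, the list
  \<open>[\<pi>(1), \<dots>, \<pi>(k)]\<close>. As lists are indexed from \<open>0\<close>, the positions
  \<open>c\<^sub>1 < \<dots> < c\<^sub>k\<close> of an occurrence appear as \<open>c 0 < \<dots> < c (k - 1)\<close>.
\<close>

definition contains_pattern :: "nat \<Rightarrow> (nat \<Rightarrow> nat) \<Rightarrow> nat list \<Rightarrow> bool" where
  "contains_pattern n \<tau> \<pi> \<longleftrightarrow>
     (\<exists>c :: nat \<Rightarrow> nat.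
        strict_mono_on {..<length \<pi>} c \<and> c ` {..<length \<pi>} \<subseteq> {1..n} \<and>
        (\<forall>i<length \<pi>. \<forall>j<length \<pi>. \<tau> (c i) < \<tau> (c j) \<longleftrightarrow> \<pi> ! i < \<pi> ! j))"

definition avoids :: "nat \<Rightarrow> (nat \<Rightarrow> nat) \<Rightarrow> nat list \<Rightarrow> bool" where
  "avoids n \<tau> \<pi> \<longleftrightarrow> \<not> contains_pattern n \<tau> \<pi>"

definition three_perms :: "nat \<Rightarrow> ((nat \<Rightarrow> nat) \<times> (nat \<Rightarrow> nat)) set" where
  "three_perms n = {\<sigma>. \<sigma> permutes {1..n}} \<times> {\<sigma>'. \<sigma>' permutes {1..n}}"

definition three_perm_avoids :: "nat \<Rightarrow> (nat \<Rightarrow> nat) \<times> (nat \<Rightarrow> nat) \<Rightarrow> nat list \<Rightarrow> bool" where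
  "three_perm_avoids n = (\<lambda>(\<sigma>, \<sigma>') \<pi>.
     avoids n \<sigma> \<pi> \<and> avoids n \<sigma>' \<pi> \<and> avoids n (\<sigma>' \<circ> inv \<sigma>) \<pi>)"

definition avoiding_three_perms ::
    "nat \<Rightarrow> nat list set \<Rightarrow> ((nat \<Rightarrow> nat) \<times> (nat \<Rightarrow> nat)) set" where
  "avoiding_three_perms n P = {p \<in> three_perms n. \<forall>\<pi>\<in>P. three_perm_avoids n p \<pi>}"

end

(* A permutation avoiding 132, 213 and 312 increases up to its maximum, at position m say, and
   every later entry is smaller than all entries before it. So it is
   (n-m+1) (n-m+2) ... n (n-m) ... 2 1, and there are n of these, one for each m.
   A pair with parameters (a, b) is counted iff some c satisfies tau_c o tau_a = tau_b.
   Evaluating at n and at 1 leaves only a = n (tau_a is the identity), a = b, and a = 1, b = n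
   (the reversal followed by itself), which gives n + (n - 1) + 1 pairs if n \<ge> 2. *)
theory Submission
  imports Defs
begin

text \<open>The parameter \<open>m\<close> is the position of the maximum \<open>n\<close>. For
  \<open>m\<close> in \<open>{1..n}\<close> both subtractions are exact, since
  \<open>i + n - m\<close> means \<open>(i + n) - m\<close>.\<close>

definition tau :: "nat \<Rightarrow> nat \<Rightarrow> nat \<Rightarrow> nat" where
  "tau n m i = (if i \<in> {1..n} then if i \<le> m then i + n - m else n + 1 - i else i)"

lemma contains_pattern_3:
  "contains_pattern n \<tau> [p, q, r] \<longleftrightarrow>
     (\<exists>x y z. 1 \<le> x \<and> x < y \<and> y < z \<and> z \<le> n \<and>
        (\<tau> x < \<tau> y \<longleftrightarrow> p < q) \<and> (\<tau> y < \<tau> x \<longleftrightarrow> q < p) \<and>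
        (\<tau> x < \<tau> z \<longleftrightarrow> p < r) \<and> (\<tau> z < \<tau> x \<longleftrightarrow> r < p) \<and>
        (\<tau> y < \<tau> z \<longleftrightarrow> q < r) \<and> (\<tau> z < \<tau> y \<longleftrightarrow> r < q))"
    (is "?L \<longleftrightarrow> (\<exists>x y z. ?R x y z)")
proof
  have lt3: "{..<length [p, q, r]} = {0, 1, 2}" by auto
  have all3: "(\<forall>i<length [p, q, r]. P i) \<longleftrightarrow> P 0 \<and> P 1 \<and> P 2" for P
    by (auto simp: less_Suc_eq numeral_2_eq_2)
  {
    assume ?L
    then obtain c where "strict_mono_on {0, 1, 2} c" "c ` {0, 1, 2} \<subseteq> {1..n}"
      and "\<forall>i<length [p, q, r]. \<forall>j<length [p, q, r].
             \<tau> (c i) < \<tau> (c j) \<longleftrightarrow> [p, q, r] ! i < [p, q, r] ! j"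
      unfolding contains_pattern_def lt3 by blast
    then have "?R (c 0) (c 1) (c 2)"
      unfolding all3 by (auto simp: strict_mono_on_def)
    then show "\<exists>x y z. ?R x y z" by blast
  next
    assume "\<exists>x y z. ?R x y z"
    then obtain x y z where R: "?R x y z" by blast
    define c where "c = (\<lambda>i::nat. if i = 0 then x else if i = 1 then y else z)"
    have "strict_mono_on {0, 1, 2} c" "c ` {0, 1, 2} \<subseteq> {1..n}"
      using R by (auto simp: strict_mono_on_def c_def)
    moreover have "\<forall>i<length [p, q, r]. \<forall>j<length [p, q, r].
             \<tau> (c i) < \<tau> (c j) \<longleftrightarrow> [p, q, r] ! i < [p, q, r] ! j"
      unfolding all3 using R by (simp add: c_def)
    ultimately show ?L unfolding contains_pattern_def lt3 by blast
  }
qed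

text \<open>Of the six possible orders of a triple only 123, 231 and 321 remain: the triple
  increases, or its last entry is the least.\<close>

lemma avoids_132_213_312_iff:
  assumes "\<tau> permutes {1..n}"
  shows "(\<forall>\<pi>\<in>{[1, 3, 2], [2, 1, 3], [3, 1, 2]}. avoids n \<tau> \<pi>) \<longleftrightarrow>
    (\<forall>x y z. 1 \<le> x \<and> x < y \<and> y < z \<and> z \<le> n \<longrightarrow>
       \<tau> x < \<tau> y \<and> \<tau> y < \<tau> z \<or> \<tau> z < \<tau> x \<and> \<tau> z < \<tau> y)" (is "?L \<longleftrightarrow> ?R")
proof -
  have "contains_pattern n \<tau> [1, 3, 2] \<longleftrightarrow>
      (\<exists>x y z. 1 \<le> x \<and> x < y \<and> y < z \<and> z \<le> n \<and> \<tau> x < \<tau> z \<and> \<tau> z < \<tau> y)"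
    and "contains_pattern n \<tau> [2, 1, 3] \<longleftrightarrow>
      (\<exists>x y z. 1 \<le> x \<and> x < y \<and> y < z \<and> z \<le> n \<and> \<tau> y < \<tau> x \<and> \<tau> x < \<tau> z)"
    and "contains_pattern n \<tau> [3, 1, 2] \<longleftrightarrow>
      (\<exists>x y z. 1 \<le> x \<and> x < y \<and> y < z \<and> z \<le> n \<and> \<tau> y < \<tau> z \<and> \<tau> z < \<tau> x)"
    unfolding contains_pattern_3 by (intro iff_exI; auto)+
  then have "?L \<longleftrightarrow> (\<forall>x y z. 1 \<le> x \<and> x < y \<and> y < z \<and> z \<le> n \<longrightarrow>
      \<not> (\<tau> x < \<tau> z \<and> \<tau> z < \<tau> y) \<and> \<not> (\<tau> y < \<tau> x \<and> \<tau> x < \<tau> z) \<and>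
      \<not> (\<tau> y < \<tau> z \<and> \<tau> z < \<tau> x))"
    unfolding avoids_def by blast
  also have "\<dots> \<longleftrightarrow> ?R"
  proof (intro iff_allI imp_cong refl)
    fix x y z assume "1 \<le> x \<and> x < y \<and> y < z \<and> z \<le> n"
    \<comment> \<open>Ties must be excluded: a triple with equal values could satisfy the three
      negations but neither alternative.\<close>
    then have "\<tau> x \<noteq> \<tau> y" "\<tau> y \<noteq> \<tau> z" "\<tau> x \<noteq> \<tau> z"
      using permutes_inj[OF assms] by (auto simp: inj_eq)
    then show "\<not> (\<tau> x < \<tau> z \<and> \<tau> z < \<tau> y) \<and> \<not> (\<tau> y < \<tau> x \<and> \<tau> x < \<tau> z) \<and>
        \<not> (\<tau> y < \<tau> z \<and> \<tau> z < \<tau> x) \<longleftrightarrow>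
      \<tau> x < \<tau> y \<and> \<tau> y < \<tau> z \<or> \<tau> z < \<tau> x \<and> \<tau> z < \<tau> y"
      by linarith
  qed
  finally show ?thesis .
qed

text \<open>A value of a permutation is its rank, because the positions with value at most
  \<open>\<tau> k\<close> are mapped bijectively onto \<open>{1..\<tau> k}\<close>. This recovers
  the values of \<open>\<tau>\<close> from comparisons between them.\<close>

lemma permutes_eq_card_le:
  assumes "\<tau> permutes {1..n}" "k \<in> {1..n}"
  shows "\<tau> k = card {x \<in> {1..n}. \<tau> x \<le> \<tau> k}"
proof -
  have "\<tau> ` {x \<in> {1..n}. \<tau> x \<le> \<tau> k} = {1..\<tau> k}"
  proof -
    have "{1..\<tau> k} \<subseteq> \<tau> ` {1..n}"
      using permutes_image[OF assms(1)] permutes_in_image[OF assms(1)] assms(2) by auto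
    moreover have "\<tau> x \<ge> 1" if "x \<in> {1..n}" for x
      using permutes_in_image[OF assms(1)] that by (metis atLeastAtMost_iff)
    ultimately show ?thesis by fastforce
  qed
  then show ?thesis
    using card_image[OF inj_on_subset[OF permutes_inj[OF assms(1)] subset_UNIV]]
    by (metis (no_types, lifting) card_atLeastAtMost diff_Suc_1 One_nat_def)
qed

lemma tau_permutes:
  assumes "m \<in> {1..n}"
  shows "tau n m permutes {1..n}"
proof (rule bij_imp_permutes)
  \<comment> \<open>The increasing branch takes values above \<open>n - m\<close>, the decreasing
    one values at most \<open>n - m\<close>, so they cannot collide.\<close>
  have "inj_on (tau n m) {1..n}"
    using assms by (auto simp: inj_on_def tau_def split: if_splits)
  moreover have "tau n m ` {1..n} \<subseteq> {1..n}"
    using assms by (auto simp: tau_def)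
  ultimately show "bij_betw (tau n m) {1..n} {1..n}"
    by (simp add: bij_betw_def endo_inj_surj)
qed (auto simp: tau_def)

lemma avoids_132_213_312_iff_tau:
  assumes perm: "\<tau> permutes {1..n}" and n: "n \<ge> 1"
  shows "(\<forall>\<pi>\<in>{[1, 3, 2], [2, 1, 3], [3, 1, 2]}. avoids n \<tau> \<pi>) \<longleftrightarrow> (\<exists>m\<in>{1..n}. \<tau> = tau n m)"
  unfolding avoids_132_213_312_iff[OF perm]
proof
  assume "\<forall>x y z. 1 \<le> x \<and> x < y \<and> y < z \<and> z \<le> n \<longrightarrow>
    \<tau> x < \<tau> y \<and> \<tau> y < \<tau> z \<or> \<tau> z < \<tau> x \<and> \<tau> z < \<tau> y"
  then have av: "\<tau> x < \<tau> y \<and> \<tau> y < \<tau> z \<or> \<tau> z < \<tau> x \<and> \<tau> z < \<tau> y"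
    if "1 \<le> x" "x < y" "y < z" "z \<le> n" for x y z using that by blast
  have inj: "\<tau> x = \<tau> y \<longleftrightarrow> x = y" for x y
    using permutes_inj[OF perm] by (auto simp: inj_eq)
  have "n \<in> \<tau> ` {1..n}" using permutes_image[OF perm] n by simp
  then obtain m where m: "m \<in> {1..n}" "\<tau> m = n" by auto
  have max: "\<tau> k < n" if "k \<in> {1..n}" "k \<noteq> m" for k
  proof -
    have "\<tau> k \<le> n" using permutes_in_image[OF perm] that(1) by (metis atLeastAtMost_iff)
    moreover have "\<tau> k \<noteq> n" using m(2) that(2) inj by metis
    ultimately show ?thesis by simp
  qed
  have inc: "\<tau> x < \<tau> y" if "1 \<le> x" "x < y" "y \<le> m" for x y
  proof (cases "y = m")
    case True
    then show ?thesis using that m max[of x] by auto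
  next
    case False
    \<comment> \<open>In the triple \<open>x\<close>, \<open>y\<close>, \<open>m\<close> the last
      entry is the maximum, so the triple must increase.\<close>
    then show ?thesis using that m max[of x] max[of y] av[of x y m] by auto
  qed
  have dec: "\<tau> k < \<tau> j" if "m < k" "1 \<le> j" "j < k" "k \<le> n" for j k
  proof -
    \<comment> \<open>For \<open>j \<noteq> m\<close>, the triple formed by \<open>j\<close>,
      \<open>m\<close> and \<open>k\<close> does not end in its maximum \<open>\<tau> m\<close>,
      hence does not increase; so its last entry \<open>\<tau> k\<close> is the least.\<close>
    consider "j = m" | "j < m" | "m < j" by linarith
    then show ?thesis
      using that m max[of k] max[of j] av[of j m k] av[of m j k] by cases auto
  qed
  have "\<tau> k = tau n m k" for k
  proof -
    consider "k \<notin> {1..n}" | "1 \<le> k" "k \<le> m" | "m < k" "k \<le> n" by fastforce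
    then show ?thesis
    proof cases
      case 1
      then show ?thesis using permutes_not_in[OF perm 1] by (auto simp: tau_def)
    next
      case 2
      \<comment> \<open>Below position \<open>k\<close> in the increasing part lie its predecessors
        and the whole tail after \<open>m\<close>, so the rank is
        \<open>k + (n - m)\<close>.\<close>
      have "\<tau> x \<le> \<tau> k \<longleftrightarrow> x \<le> k \<or> m < x" if "x \<in> {1..n}" for x
        using that 2 inc[of x k] inc[of k x] dec[of x k] dec[of k x] dec[of x m]
        by (cases x k rule: linorder_cases; cases "m < x") auto
      then have "{x \<in> {1..n}. \<tau> x \<le> \<tau> k} = {1..k} \<union> {m<..n}"
        using 2 m by auto
      moreover have "card ({1..k} \<union> {m<..n}) = k + (n - m)"
        using 2 by (subst card_Un_disjoint) auto
      ultimately show ?thesis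
        using permutes_eq_card_le[OF perm, of k] 2 m by (simp add: tau_def)
    next
      case 3
      \<comment> \<open>In the tail only \<open>k\<close> itself and later positions have values at
        most \<open>\<tau> k\<close>, which gives rank \<open>n + 1 - k\<close>.\<close>
      have "\<tau> x \<le> \<tau> k \<longleftrightarrow> k \<le> x" if "x \<in> {1..n}" for x
        using that 3 dec[of k x] dec[of x k] by (cases x k rule: linorder_cases) auto
      then have "{x \<in> {1..n}. \<tau> x \<le> \<tau> k} = {k..n}"
        using 3 by auto
      then show ?thesis
        using permutes_eq_card_le[OF perm, of k] 3 m by (simp add: tau_def)
    qed
  qed
  then show "\<exists>m\<in>{1..n}. \<tau> = tau n m" using m by blast
next
  assume "\<exists>m\<in>{1..n}. \<tau> = tau n m"
  then obtain m where m: "m \<in> {1..n}" "\<tau> = tau n m" by blast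
  show "\<forall>x y z. 1 \<le> x \<and> x < y \<and> y < z \<and> z \<le> n \<longrightarrow>
    \<tau> x < \<tau> y \<and> \<tau> y < \<tau> z \<or> \<tau> z < \<tau> x \<and> \<tau> z < \<tau> y"
  proof (intro allI impI)
    fix x y z assume "1 \<le> x \<and> x < y \<and> y < z \<and> z \<le> n"
    then show "\<tau> x < \<tau> y \<and> \<tau> y < \<tau> z \<or> \<tau> z < \<tau> x \<and> \<tau> z < \<tau> y"
      \<comment> \<open>The triple increases if \<open>z \<le> m\<close>; otherwise \<open>z\<close>
        lies in the tail and its value is the least.\<close>
      using m by (cases "z \<le> m"; cases "y \<le> m"; cases "x \<le> m"; simp add: tau_def; linarith)
  qed
qed

lemma tau_self: "tau n n = id"
  by (auto simp: tau_def)

lemma tau_eq_iff: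
  assumes "a \<in> {1..n}" "b \<in> {1..n}"
  shows "tau n a = tau n b \<longleftrightarrow> a = b"
proof
  assume "tau n a = tau n b"
  \<comment> \<open>Position 1 always lies in the increasing part, so the first value
    \<open>1 + n - m\<close> determines \<open>m\<close>.\<close>
  then have "tau n a 1 = tau n b 1" by simp
  then show "a = b" using assms by (auto simp: tau_def)
qed simp

lemma tau_comp_iff:
  assumes "a \<in> {1..n}" "b \<in> {1..n}"
  shows "(\<exists>c\<in>{1..n}. tau n c \<circ> tau n a = tau n b) \<longleftrightarrow> a = n \<or> a = b \<or> a = 1 \<and> b = n"
proof
  assume "\<exists>c\<in>{1..n}. tau n c \<circ> tau n a = tau n b"
  then obtain c where c: "c \<in> {1..n}" and eq: "tau n c \<circ> tau n a = tau n b" by blast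
  have at: "tau n c (tau n a i) = tau n b i" for i using eq by (metis comp_apply)
  show "a = n \<or> a = b \<or> a = 1 \<and> b = n"
  proof (rule ccontr)
    assume *: "\<not> ?thesis"
    \<comment> \<open>Since \<open>a \<noteq> n\<close>, position \<open>n\<close> lies in the
      decreasing part of \<open>tau n a\<close>.\<close>
    have "tau n a n = 1" "tau n c 1 = 1 + n - c" using * assms c by (auto simp: tau_def)
    then have "1 + n - c = tau n b n" using at[of n] by simp
    \<comment> \<open>If \<open>c = n\<close>, the left factor is the identity and
      \<open>a = b\<close>. With this excluded, \<open>1 + n - c\<close> is not 1, whereas
      \<open>tau n b n\<close> is 1 unless \<open>b = n\<close>.\<close>
    moreover have "c \<noteq> n" using eq * assms tau_eq_iff by (auto simp: tau_self)
    ultimately have "b = n" "c = 1" using c assms by (auto simp: tau_def split: if_splits)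
    \<comment> \<open>Now \<open>tau n c\<close> is the reversal and \<open>tau n b\<close> the
      identity. The reversal sends \<open>tau n a 1 = 1 + n - a\<close> to \<open>a\<close>, so
      \<open>a = 1\<close>, the remaining excluded case.\<close>
    then show False using at[of 1] * assms by (auto simp: tau_def split: if_splits)
  qed
next
  \<comment> \<open>The three cases have witnesses \<open>c = b\<close>, \<open>c = n\<close> and
    \<open>c = 1\<close>; the last one uses that the reversal is an involution.\<close>
  have "tau n 1 \<circ> tau n 1 = tau n n" by (auto simp: tau_def fun_eq_iff)
  then show "\<exists>c\<in>{1..n}. tau n c \<circ> tau n a = tau n b" if "a = n \<or> a = b \<or> a = 1 \<and> b = n"
    using that assms tau_self by (metis comp_id id_comp atLeastAtMost_iff le_refl order_trans)
qed

lemma avoiding_three_perms_eq: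
  assumes n: "n \<ge> 1"
  shows "avoiding_three_perms n {[1, 3, 2], [2, 1, 3], [3, 1, 2]} =
    map_prod (tau n) (tau n) `
      {(a, b). a \<in> {1..n} \<and> b \<in> {1..n} \<and> (a = n \<or> a = b \<or> a = 1 \<and> b = n)}"
    (is "avoiding_three_perms n ?P = map_prod _ _ ` ?I")
proof -
  have "(\<sigma>, \<sigma>') \<in> avoiding_three_perms n ?P \<longleftrightarrow> (\<sigma>, \<sigma>') \<in> map_prod (tau n) (tau n) ` ?I" for \<sigma> \<sigma>'
  proof -
    \<comment> \<open>Composing with \<open>\<sigma>\<close> on the right removes the inverse and
      brings the third condition into the form of \<open>tau_comp_iff\<close>.\<close>
    have comp: "\<sigma>' \<circ> inv \<sigma> = \<rho> \<longleftrightarrow> \<rho> \<circ> \<sigma> = \<sigma>'" if "\<sigma> permutes {1..n}" for \<rho>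
      using permutes_inv_o[OF that] by (metis comp_assoc comp_id)
    have "(\<sigma>, \<sigma>') \<in> avoiding_three_perms n ?P \<longleftrightarrow> \<sigma> permutes {1..n} \<and> \<sigma>' permutes {1..n} \<and>
        (\<exists>a\<in>{1..n}. \<sigma> = tau n a) \<and> (\<exists>b\<in>{1..n}. \<sigma>' = tau n b) \<and>
        (\<exists>c\<in>{1..n}. \<sigma>' \<circ> inv \<sigma> = tau n c)" (is "_ \<longleftrightarrow> ?B")
    proof (cases "\<sigma> permutes {1..n} \<and> \<sigma>' permutes {1..n}")
      case True
      then have "\<sigma>' \<circ> inv \<sigma> permutes {1..n}"
        by (simp add: permutes_compose permutes_inv)
      note perms = conjunct1[OF True] conjunct2[OF True] this
      have "(\<sigma>, \<sigma>') \<in> avoiding_three_perms n ?P \<longleftrightarrow> (\<forall>\<pi>\<in>?P. avoids n \<sigma> \<pi>) \<and> (\<forall>\<pi>\<in>?P. avoids n \<sigma>' \<pi>) \<and>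
          (\<forall>\<pi>\<in>?P. avoids n (\<sigma>' \<circ> inv \<sigma>) \<pi>)"
        using True
        unfolding avoiding_three_perms_def three_perms_def three_perm_avoids_def by blast
      then show ?thesis
        unfolding perms[THEN avoids_132_213_312_iff_tau[OF _ n]] using True by blast
    qed (auto simp: avoiding_three_perms_def three_perms_def)
    also have "\<dots> \<longleftrightarrow> (\<exists>a\<in>{1..n}. \<exists>b\<in>{1..n}. \<sigma> = tau n a \<and> \<sigma>' = tau n b \<and>
        (\<exists>c\<in>{1..n}. tau n c \<circ> tau n a = tau n b))"
      using tau_permutes comp by blast
    also have "\<dots> \<longleftrightarrow> (\<exists>a\<in>{1..n}. \<exists>b\<in>{1..n}. \<sigma> = tau n a \<and> \<sigma>' = tau n b \<and>
        (a = n \<or> a = b \<or> a = 1 \<and> b = n))"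
      by (intro bex_cong refl conj_cong) (rule tau_comp_iff)
    also have "\<dots> \<longleftrightarrow> (\<sigma>, \<sigma>') \<in> map_prod (tau n) (tau n) ` ?I"
      by (simp only: image_iff Bex_def split_paired_Ex map_prod_simp prod.inject mem_Collect_eq
          case_prod_conv) blast
    finally show ?thesis .
  qed
  then show ?thesis by auto
qed

lemma card_avoiding_three_perms:
  assumes "n \<ge> 1"
  shows "card (avoiding_three_perms n {[1, 3, 2], [2, 1, 3], [3, 1, 2]}) = (if n = 1 then 1 else 2 * n)"
proof -
  let ?I = "{(a, b). a \<in> {1..n} \<and> b \<in> {1..n} \<and> (a = n \<or> a = b \<or> a = 1 \<and> b = n)}"
  have "inj_on (map_prod (tau n) (tau n)) ?I"
    by (auto simp: inj_on_def tau_eq_iff)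
  then have "card (avoiding_three_perms n {[1, 3, 2], [2, 1, 3], [3, 1, 2]}) = card ?I"
    unfolding avoiding_three_perms_eq[OF assms] by (rule card_image)
  also have "\<dots> = (if n = 1 then 1 else 2 * n)"
  proof (cases "n = 1")
    \<comment> \<open>For \<open>n = 1\<close> the exceptional pair \<open>(1, n)\<close> coincides
      with \<open>(n, n)\<close>, so the general count would be too large by one.\<close>
    case True
    then have "?I = {(1, 1)}" by auto
    with True show ?thesis by simp
  next
    case False
    \<comment> \<open>The row \<open>a = n\<close> already contains \<open>(n, n)\<close>, so the
      diagonal stops before \<open>n\<close>; the pair \<open>(1, n)\<close> is new because
      \<open>n \<noteq> 1\<close>.\<close>
    have "?I = insert (1, n) ({n} \<times> {1..n} \<union> (\<lambda>a. (a, a)) ` {1..<n})"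
      using assms by auto
    also have "card \<dots> = Suc (card ({n} \<times> {1..n} \<union> (\<lambda>a. (a, a)) ` {1..<n}))"
      using False by (subst card_insert_disjoint) auto
    also have "card ({n} \<times> {1..n} \<union> (\<lambda>a. (a, a)) ` {1..<n}) = n + (n - 1)"
      by (subst card_Un_disjoint) (auto simp: card_image inj_on_def card_cartesian_product)
    finally show ?thesis using False assms by simp
  qed
  finally show ?thesis .
qed

theorem theorem4p1:
  fixes a :: "nat \<Rightarrow> nat"
  assumes a_def: "\<And>n. n \<ge> 1 \<Longrightarrow>
    a n = card (avoiding_three_perms n {[1, 3, 2], [2, 1, 3], [3, 1, 2]})"
  shows "a 1 = 1 \<and> (\<forall>n\<ge>1. a (n + 1) = 2 * (n + 1))"
  by (simp add: a_def card_avoiding_three_perms del: One_nat_def)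

end
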